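(* Let $(X,\tau)$ and $(Y,\sigma)$ be topological spaces and let $f \colon (X,\tau) \rightarrow (Y,\sigma)$ be a function. The following conditions are equivalent: (1) $f$ is $SR$-continuous. (2) $f$ is $\beta$-continuous, $\mathcal{B}$-continuous and contra-gs-continuous.
   Context: No separation axioms are assumed and functions are not assumed continuous. For a subset $A$ of a topological space, $\mathrm{Int}(A)$ and $\mathrm{Cl}(A)$ denote interior and closure. $A$ is semi-open if $A \subseteq \mathrm{Cl}(\mathrm{Int}(A))$; semi-closed if its complement is semi-open (equivalently $\mathrm{Int}(\mathrm{Cl}(A)) \subseteq A$); semi-regular if it is both semi-open and semi-closed; $\beta$-open if $A \subseteq \mathrm{Cl}(\mathrm{Int}(\mathrm{Cl}(A)))$. $A$ is a $\mathcal{B}$-set if it is the intersection of an open set and a semi-closed set. The semi-closure $\mathrm{sCl}(A)$ is the intersection of all semi-closed sets containing $A$. $A$ is gs-closed if $\mathrm{sCl}(A) \subseteq U$ whenever $A \subseteq U$ and $U$ is open. A function $f \colon (X,\tau)\to(Y,\sigma)$ is $SR$-continuous (resp. $\beta$-continuous, $\mathcal{B}$-continuous, contra-gs-continuous) if the preimage of every open subset of $Y$ is semi-regular (resp. $\beta$-open, a $\mathcal{B}$-set, gs-closed) in $X$. *)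

theory Defs
  imports "HOL-Analysis.Abstract_Topology"
begin

text \<open>
  Spaces are abstract topologies, so carriers are arbitrary (possibly empty) sets and no
  separation axioms are present. The predicates on sets hold only for subsets of the carrier;
  where this is not stated it follows from \<^term>\<open>X closure_of S \<subseteq> topspace X\<close>.
\<close>

definition semi_openin :: "'a topology \<Rightarrow> 'a set \<Rightarrow> bool" where
  "semi_openin X A \<longleftrightarrow> A \<subseteq> X closure_of (X interior_of A)"

definition semi_closedin :: "'a topology \<Rightarrow> 'a set \<Rightarrow> bool" where
  "semi_closedin X A \<longleftrightarrow> A \<subseteq> topspace X \<and> semi_openin X (topspace X - A)"

definition semi_regularin :: "'a topology \<Rightarrow> 'a set \<Rightarrow> bool" where
  "semi_regularin X A \<longleftrightarrow> semi_openin X A \<and> semi_closedin X A"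

definition beta_openin :: "'a topology \<Rightarrow> 'a set \<Rightarrow> bool" where
  "beta_openin X A \<longleftrightarrow> A \<subseteq> X closure_of (X interior_of (X closure_of A))"

definition B_setin :: "'a topology \<Rightarrow> 'a set \<Rightarrow> bool" where
  "B_setin X A \<longleftrightarrow> (\<exists>U F. openin X U \<and> semi_closedin X F \<and> A = U \<inter> F)"

text \<open>
  For \<open>A \<subseteq> topspace X\<close> the family below is nonempty, since \<open>topspace X\<close> belongs to it.
\<close>

definition semi_closure_of :: "'a topology \<Rightarrow> 'a set \<Rightarrow> 'a set" where
  "semi_closure_of X A = \<Inter> {F. semi_closedin X F \<and> A \<subseteq> F}"

definition gs_closedin :: "'a topology \<Rightarrow> 'a set \<Rightarrow> bool" where
  "gs_closedin X A \<longleftrightarrow>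
     A \<subseteq> topspace X \<and> (\<forall>U. openin X U \<and> A \<subseteq> U \<longrightarrow> semi_closure_of X A \<subseteq> U)"

text \<open>
  The following are meant for maps \<open>f \<in> topspace X \<rightarrow> topspace Y\<close>; unlike in
  \<^const>\<open>continuous_map\<close>, this is not part of the definitions. The set
  \<open>{x \<in> topspace X. f x \<in> V}\<close> is the preimage of \<open>V\<close> in \<open>X\<close>.
\<close>

definition SR_continuous_map :: "'a topology \<Rightarrow> 'b topology \<Rightarrow> ('a \<Rightarrow> 'b) \<Rightarrow> bool" where
  "SR_continuous_map X Y f \<longleftrightarrow>
     (\<forall>V. openin Y V \<longrightarrow> semi_regularin X {x \<in> topspace X. f x \<in> V})"

definition beta_continuous_map :: "'a topology \<Rightarrow> 'b topology \<Rightarrow> ('a \<Rightarrow> 'b) \<Rightarrow> bool" where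
  "beta_continuous_map X Y f \<longleftrightarrow>
     (\<forall>V. openin Y V \<longrightarrow> beta_openin X {x \<in> topspace X. f x \<in> V})"

definition B_continuous_map :: "'a topology \<Rightarrow> 'b topology \<Rightarrow> ('a \<Rightarrow> 'b) \<Rightarrow> bool" where
  "B_continuous_map X Y f \<longleftrightarrow>
     (\<forall>V. openin Y V \<longrightarrow> B_setin X {x \<in> topspace X. f x \<in> V})"

definition contra_gs_continuous_map :: "'a topology \<Rightarrow> 'b topology \<Rightarrow> ('a \<Rightarrow> 'b) \<Rightarrow> bool" where
  "contra_gs_continuous_map X Y f \<longleftrightarrow>
     (\<forall>V. openin Y V \<longrightarrow> gs_closedin X {x \<in> topspace X. f x \<in> V})"

end

theory Submission
  imports Defs
begin

text \<open>
  The equivalence holds set by set. If \<open>A = U \<inter> F\<close> is gs-closed, with \<open>U\<close> open and \<open>F\<close> semi-closed,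
  then the semi-closure of \<open>A\<close> lies in both \<open>U\<close> and \<open>F\<close>, so \<open>A\<close> is semi-closed, i.e. the interior
  of its closure is contained in \<open>A\<close>. That open set is then contained in the interior of \<open>A\<close>, and
  \<open>\<beta>\<close>-openness of \<open>A\<close> becomes semi-openness.
\<close>

text \<open>Complementation in the carrier exchanges interior and closure.\<close>

lemma semi_closedin_iff:
  "semi_closedin X A \<longleftrightarrow> A \<subseteq> topspace X \<and> X interior_of (X closure_of A) \<subseteq> A"
proof (cases "A \<subseteq> topspace X")
  case True
  have "X closure_of (X interior_of (topspace X - A)) = topspace X - X interior_of (X closure_of A)"
    by (simp only: interior_of_complement closure_of_complement)
  then show ?thesis
    using True interior_of_subset_topspace[of X "X closure_of A"]
    unfolding semi_closedin_def semi_openin_def by blast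
next
  case False
  then show ?thesis by (simp add: semi_closedin_def)
qed

lemma semi_closure_of_minimal: "semi_closedin X F \<Longrightarrow> A \<subseteq> F \<Longrightarrow> semi_closure_of X A \<subseteq> F"
  by (auto simp: semi_closure_of_def)

text \<open>Every semi-closed \<open>F\<close> containing \<open>A\<close> also contains the
  interior of its own closure, hence that of the closure of \<open>A\<close>. This yields
  semi-closedness from \<open>semi_closure_of X A \<subseteq> A\<close> without showing that
  intersections of semi-closed sets are semi-closed.\<close>

lemma interior_closure_subset_semi_closure_of:
  "X interior_of (X closure_of A) \<subseteq> semi_closure_of X A"
  unfolding semi_closure_of_def
proof (rule Inter_greatest, clarify)
  fix F x
  assume "semi_closedin X F" "A \<subseteq> F" "x \<in> X interior_of (X closure_of A)"
  then show "x \<in> F"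
    using interior_of_mono[OF closure_of_mono[OF \<open>A \<subseteq> F\<close>], of X X]
    unfolding semi_closedin_iff by blast
qed

lemma semi_openin_imp_beta_openin:
  assumes "semi_openin X A"
  shows "beta_openin X A"
proof -
  have "A \<subseteq> topspace X"
    using assms closure_of_subset_topspace unfolding semi_openin_def by (rule order.trans)
  then have "A \<subseteq> X closure_of A"
    by (rule closure_of_subset)
  then have "X closure_of (X interior_of A) \<subseteq> X closure_of (X interior_of (X closure_of A))"
    by (intro closure_of_mono interior_of_mono)
  then show ?thesis
    using assms unfolding semi_openin_def beta_openin_def by blast
qed

lemma semi_closedin_iff_B_setin_gs_closedin:
  "semi_closedin X A \<longleftrightarrow> B_setin X A \<and> gs_closedin X A"
proof (intro iffI conjI)
  assume A: "semi_closedin X A"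
  then have "A \<subseteq> topspace X"
    by (simp add: semi_closedin_iff)
  \<comment> \<open>The open factor is the whole carrier.\<close>
  then show "B_setin X A"
    using A unfolding B_setin_def by (metis inf.absorb2 openin_topspace)
  show "gs_closedin X A"
    using A \<open>A \<subseteq> topspace X\<close> semi_closure_of_minimal[OF A order.refl]
    unfolding gs_closedin_def by blast
next
  assume *: "B_setin X A \<and> gs_closedin X A"
  then obtain U F where "openin X U" "semi_closedin X F" "A = U \<inter> F"
    unfolding B_setin_def by blast
  \<comment> \<open>\<open>U\<close> is itself an open superset of \<open>A\<close>, so
    gs-closedness applies to it.\<close>
  moreover from this * have "semi_closure_of X A \<subseteq> U"
    unfolding gs_closedin_def by blast
  ultimately have "semi_closure_of X A \<subseteq> A"
    using semi_closure_of_minimal[of X F A] by blast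
  then show "semi_closedin X A"
    using * interior_closure_subset_semi_closure_of[of X A]
    by (auto simp: semi_closedin_iff gs_closedin_def)
qed

lemma semi_regularin_iff_beta_openin_semi_closedin:
  "semi_regularin X A \<longleftrightarrow> beta_openin X A \<and> semi_closedin X A"
proof
  assume "semi_regularin X A"
  then show "beta_openin X A \<and> semi_closedin X A"
    by (simp add: semi_regularin_def semi_openin_imp_beta_openin)
next
  assume *: "beta_openin X A \<and> semi_closedin X A"
  then have "X interior_of (X closure_of A) \<subseteq> X interior_of A"
    by (simp add: interior_of_maximal semi_closedin_iff)
  then have "X closure_of (X interior_of (X closure_of A)) \<subseteq> X closure_of (X interior_of A)"
    by (rule closure_of_mono)
  with * have "semi_openin X A"
    unfolding beta_openin_def semi_openin_def by blast
  with * show "semi_regularin X A"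
    by (simp add: semi_regularin_def)
qed

theorem corollary3p15:
  fixes X :: "'a topology" and Y :: "'b topology" and f :: "'a \<Rightarrow> 'b"
  assumes "f \<in> topspace X \<rightarrow> topspace Y"
  shows "SR_continuous_map X Y f \<longleftrightarrow>
    beta_continuous_map X Y f \<and> B_continuous_map X Y f \<and> contra_gs_continuous_map X Y f"
  \<comment> \<open>After rewriting each preimage condition, it remains to distribute the quantifier
    over \<open>V\<close> across a conjunction.\<close>
  unfolding SR_continuous_map_def beta_continuous_map_def B_continuous_map_def
    contra_gs_continuous_map_def semi_regularin_iff_beta_openin_semi_closedin
    semi_closedin_iff_B_setin_gs_closedin
  by blast

end
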